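(* Let $(\mathbb{R}^{3},g_{Nil})$ denote Nil space, where the metric with respect to the standard coordinates $(x,y,z)$ in $\mathbb{R}^{3}$ is $g_{Nil}={\rm d}x^{2}+{\rm d}y^{2}+({\rm d}z-x\,{\rm d}y)^{2}$. Let $A_1,A_2,A_3$ be real $m\times m$ matrices. Then the quadratic map $\varphi:\mathbb{R}^{m}\to(\mathbb{R}^{3},g_{Nil})$, $\varphi(X)=(X^{t}A_{1}X,X^{t}A_{2}X,X^{t}A_{3}X)$ (with the standard Euclidean metric on $\mathbb{R}^m$), into Nil space is $\infty$-harmonic if and only if it is a constant map.
   Context: A smooth map $\varphi:(M,g)\to(N,h)$ between Riemannian manifolds is called $\infty$-harmonic if $\tfrac12\,{\rm d}\varphi({\rm grad}\,|{\rm d}\varphi|^2)=0$ on $M$, where $|{\rm d}\varphi|^2={\rm Trace}_g\,\varphi^*h$ is the energy density of $\varphi$ and the gradient is taken with respect to $g$. *)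

theory Defs
  imports "HOL-Analysis.Analysis"
begin

(* C^k: all iterated directional derivatives up to order k exist (as derivatives of Frechet
   differentiable maps) and are continuous. *)
primrec Ck :: "nat \<Rightarrow> ('a::euclidean_space \<Rightarrow> 'b::real_normed_vector) \<Rightarrow> bool" where
  "Ck 0 f \<longleftrightarrow> continuous_on UNIV f"
| "Ck (Suc k) f \<longleftrightarrow>
     (\<forall>x. f differentiable (at x)) \<and> (\<forall>v. Ck k (\<lambda>x. frechet_derivative f (at x) v))"

definition smooth :: "('a::euclidean_space \<Rightarrow> 'b::real_normed_vector) \<Rightarrow> bool" where
  "smooth f \<longleftrightarrow> (\<forall>k. Ck k f)"

(* A metric on R^n is given in the global standard coordinates: g p v w is the inner product
   of the tangent vectors v, w at the point p. *)
type_synonym 'n metric = "real ^ 'n \<Rightarrow> real ^ 'n \<Rightarrow> real ^ 'n \<Rightarrow> real"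

definition riemannian_metric :: "'n::finite metric \<Rightarrow> bool" where
  "riemannian_metric g \<longleftrightarrow>
     (\<forall>p. bilinear (g p)) \<and>
     (\<forall>p v w. g p v w = g p w v) \<and>
     (\<forall>p v. v \<noteq> 0 \<longrightarrow> 0 < g p v v) \<and>
     (\<forall>v w. smooth (\<lambda>p. g p v w))"

definition gram_matrix :: "(real ^ 'n \<Rightarrow> real ^ 'n \<Rightarrow> real) \<Rightarrow> real ^ 'n ^ 'n" where
  "gram_matrix b = (\<chi> i j. b (axis i 1) (axis j 1))"

(* The g-trace g^{ij} b_{ij} of a bilinear form b at the point p. *)
definition metric_trace ::
    "'n::finite metric \<Rightarrow> real ^ 'n \<Rightarrow> (real ^ 'n \<Rightarrow> real ^ 'n \<Rightarrow> real) \<Rightarrow> real" where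
  "metric_trace g p b =
     (\<Sum>i\<in>UNIV. \<Sum>j\<in>UNIV. matrix_inv (gram_matrix (g p)) $ i $ j * gram_matrix b $ i $ j)"

definition pullback :: "(real ^ 'm \<Rightarrow> real ^ 'n) \<Rightarrow> 'n::finite metric \<Rightarrow> 'm::finite metric" where
  "pullback \<phi> h p v w =
     h (\<phi> p) (frechet_derivative \<phi> (at p) v) (frechet_derivative \<phi> (at p) w)"

definition energy_density ::
    "'m::finite metric \<Rightarrow> 'n::finite metric \<Rightarrow> (real ^ 'm \<Rightarrow> real ^ 'n) \<Rightarrow> real ^ 'm \<Rightarrow> real" where
  "energy_density g h \<phi> p = metric_trace g p (pullback \<phi> h p)"

definition grad :: "'n::finite metric \<Rightarrow> (real ^ 'n \<Rightarrow> real) \<Rightarrow> real ^ 'n \<Rightarrow> real ^ 'n" where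
  "grad g f p = (THE v. \<forall>w. g p v w = frechet_derivative f (at p) w)"

definition infinity_harmonic ::
    "'m::finite metric \<Rightarrow> 'n::finite metric \<Rightarrow> (real ^ 'm \<Rightarrow> real ^ 'n) \<Rightarrow> bool" where
  "infinity_harmonic g h \<phi> \<longleftrightarrow>
     smooth \<phi> \<and>
     (\<forall>p. (1 / 2) *\<^sub>R frechet_derivative \<phi> (at p) (grad g (energy_density g h \<phi>) p) = 0)"

definition flat_metric :: "'n::finite metric" where
  "flat_metric p v w = v \<bullet> w"

(* dx^2 + dy^2 + (dz - x dy)^2, polarised *)
definition nil_metric :: "3 metric" where
  "nil_metric p v w =
     v $ 1 * w $ 1 + v $ 2 * w $ 2 + (v $ 3 - p $ 1 * v $ 2) * (w $ 3 - p $ 1 * w $ 2)"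

definition quadratic_map ::
    "real ^ 'm ^ 'm \<Rightarrow> real ^ 'm ^ 'm \<Rightarrow> real ^ 'm ^ 'm \<Rightarrow> real ^ 'm \<Rightarrow> real ^ 3" where
  "quadratic_map A1 A2 A3 X = vector [X \<bullet> (A1 *v X), X \<bullet> (A2 *v X), X \<bullet> (A3 *v X)]"

lemma grad_characterization:
  assumes g: "riemannian_metric g" and f: "f differentiable (at p)"
  shows "g p (grad g f p) w = frechet_derivative f (at p) w"
proof -
  let ?D = "frechet_derivative f (at p)"
  have bil: "bilinear (g p)" and pos: "\<And>v. v \<noteq> 0 \<Longrightarrow> 0 < g p v v"
    using g by (auto simp: riemannian_metric_def)
  have linr: "linear (g p v)" for v
    using bil by (simp add: bilinear_def)
  have linD: "linear ?D"
    using f by (rule linear_frechet_derivative)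
  define L where "L v = (\<chi> i. g p v (axis i 1))" for v
  have linL: "linear L"
    by (rule linearI) (simp_all add: L_def vec_eq_iff bilinear_ladd[OF bil] bilinear_lmul[OF bil])
  have ext: "g p v w = F w" if "linear F" "\<And>i. g p v (axis i 1) = F (axis i 1)" for v w F
  proof -
    have "g p v = F"
      by (rule linear_eq_stdbasis[OF linr that(1)])
        (use that(2) in \<open>auto simp: Basis_vec_def\<close>)
    then show ?thesis by simp
  qed
  have "inj L"
    unfolding linear_injective_0[OF linL]
  proof (intro allI impI)
    fix v assume "L v = 0"
    then have "g p v (axis i 1) = 0" for i
      by (simp add: L_def vec_eq_iff)
    then have "g p v v = 0"
      using ext[of "\<lambda>_. 0" v v] by (simp add: linear_zero)
    then show "v = 0" using pos[of v] by fastforce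
  qed
  then have "surj L"
    using linL linear_injective_imp_surjective by blast
  then obtain v where v: "L v = (\<chi> i. ?D (axis i 1))"
    by (metis surjD)
  have v': "\<forall>w. g p v w = ?D w"
    using ext[OF linD, of v] v by (simp add: L_def vec_eq_iff)
  moreover have "u = v" if "\<forall>w. g p u w = ?D w" for u
    using \<open>inj L\<close> that v' by (auto simp: L_def vec_eq_iff inj_def)
  ultimately have "\<forall>w. g p (grad g f p) w = ?D w"
    unfolding grad_def by (rule theI)
  then show ?thesis by blast
qed

lemma smooth_quadratic_coord:
  "smooth (\<lambda>p::real ^ 'n. a + b * p $ i + c * (p $ i)\<^sup>2)"
proof -
  have "Ck k (\<lambda>p::real ^ 'n. a + b * p $ i + c * (p $ i)\<^sup>2)" for k
  proof (induction k arbitrary: a b c)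
    case 0
    show ?case by (auto intro!: continuous_intros)
  next
    case (Suc k)
    have D: "((\<lambda>p::real ^ 'n. a + b * p $ i + c * (p $ i)\<^sup>2) has_derivative
        (\<lambda>v. b * v $ i + c * (2 * p $ i * v $ i))) (at p)" for p
      by (auto intro!: derivative_eq_intros bounded_linear.has_derivative[OF bounded_linear_vec_nth]
          simp: algebra_simps)
    have "frechet_derivative (\<lambda>p::real ^ 'n. a + b * p $ i + c * (p $ i)\<^sup>2) (at p) v
        = b * v $ i + (2 * c * v $ i) * p $ i + 0 * (p $ i)\<^sup>2" for p v
      by (simp add: frechet_derivative_at[OF D, symmetric])
    then show ?case
      using D by (simp only: Ck.simps Suc.IH simp_thms differentiable_def) blast
  qed
  then show ?thesis by (simp add: smooth_def)
qed

lemma riemannian_metric_flat: "riemannian_metric flat_metric"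
proof -
  have "smooth (\<lambda>p::real ^ 'n. c)" for c :: real
    using smooth_quadratic_coord[of c 0 undefined 0] by simp
  then show ?thesis
    by (auto simp: riemannian_metric_def flat_metric_def inner_commute bilinear_def
        inner_left_distrib inner_right_distrib intro!: linearI)
qed

lemma riemannian_metric_nil: "riemannian_metric nil_metric"
  unfolding riemannian_metric_def
proof (intro conjI allI impI)
  show "bilinear (nil_metric p)" for p
    by (auto simp: bilinear_def nil_metric_def algebra_simps intro!: linearI)
  show "nil_metric p v w = nil_metric p w v" for p v w
    by (simp add: nil_metric_def algebra_simps)
  show "0 < nil_metric p v v" if "v \<noteq> 0" for p v
  proof (rule ccontr)
    assume "\<not> ?thesis"
    then have "(v $ 1)\<^sup>2 + (v $ 2)\<^sup>2 + (v $ 3 - p $ 1 * v $ 2)\<^sup>2 \<le> 0"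
      by (simp add: nil_metric_def power2_eq_square)
    then have "v $ 1 = 0 \<and> v $ 2 = 0 \<and> v $ 3 - p $ 1 * v $ 2 = 0"
      by (smt (verit) zero_le_power2 power2_eq_iff_nonneg zero_eq_power2)
    then show False using that by (simp add: vec_eq_iff forall_3)
  qed
  show "smooth (\<lambda>p. nil_metric p v w)" for v w
  proof -
    have "(\<lambda>p. nil_metric p v w) = (\<lambda>p. (v $ 1 * w $ 1 + v $ 2 * w $ 2 + v $ 3 * w $ 3)
        + (- (v $ 2 * w $ 3 + v $ 3 * w $ 2)) * p $ 1 + (v $ 2 * w $ 2) * (p $ 1)\<^sup>2)"
      by (simp add: fun_eq_iff nil_metric_def algebra_simps power2_eq_square)
    then show ?thesis
      by (simp only: smooth_quadratic_coord)
  qed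
qed

end

theory Submission
  imports Defs
begin

text \<open>Put \<open>B\<^sub>k = A\<^sub>k + A\<^sub>k\<^sup>t\<close> and \<open>S = B\<^sub>1\<^sup>2 + B\<^sub>2\<^sup>2 + B\<^sub>3\<^sup>2\<close>. The energy density is a sum of homogeneous
  parts of degrees 2, 4 and 6, and the degree 2 part alone decides: it gives \<open>X\<^sup>t S B\<^sub>k X = 0\<close> for
  all \<open>X\<close>, so \<open>S\<close> anticommutes with every \<open>B\<^sub>k\<close>. Hence \<open>tr (S B\<^sub>k\<^sup>2) = - tr (S B\<^sub>k\<^sup>2) = 0\<close>, and
  summing over \<open>k\<close> yields \<open>tr (S\<^sup>2) = 0\<close>; thus \<open>S = 0\<close>, then \<open>tr S = 0\<close>, and every \<open>B\<^sub>k\<close>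
  vanishes.\<close>

lemma transpose_add: "transpose (A + B) = transpose A + transpose B"
  by (simp add: transpose_def vec_eq_iff)

text \<open>Symmetry turns the trace into the squared Frobenius norm, which is what makes vanishing
  traces informative.\<close>

lemma trace_symmetric_square:
  fixes B :: "real ^ 'n ^ 'n"
  assumes "transpose B = B"
  shows "trace (B ** B) = (\<Sum>i\<in>UNIV. \<Sum>j\<in>UNIV. (B $ i $ j)\<^sup>2)"
proof -
  have "B $ j $ i = B $ i $ j" for i j
    using assms by (metis transpose_def vec_lambda_beta)
  then show ?thesis
    by (simp add: trace_def matrix_matrix_mult_def power2_eq_square)
qed

lemma trace_symmetric_square_nonneg:
  fixes B :: "real ^ 'n ^ 'n"
  assumes "transpose B = B"
  shows "0 \<le> trace (B ** B)"
  by (simp add: trace_symmetric_square[OF assms] sum_nonneg)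

lemma trace_symmetric_square_eq_0_iff:
  fixes B :: "real ^ 'n ^ 'n"
  assumes "transpose B = B"
  shows "trace (B ** B) = 0 \<longleftrightarrow> B = 0"
  by (simp add: trace_symmetric_square[OF assms] sum_nonneg_eq_0_iff sum_nonneg vec_eq_iff)

text \<open>Polarisation: evaluating the form at the sum of two basis vectors isolates the
  symmetrised entries of \<open>C\<close>.\<close>

lemma quadratic_form_eq_0_imp_skew:
  fixes C :: "real ^ 'n ^ 'n"
  assumes "\<And>x. x \<bullet> (C *v x) = 0"
  shows "transpose C = - C"
proof -
  have "axis j 1 \<bullet> (C *v axis i 1) + axis i 1 \<bullet> (C *v axis j 1) = 0" for i j
    using assms[of "axis i 1 + axis j 1"] assms[of "axis i 1"] assms[of "axis j 1"]
    by (simp add: matrix_vector_right_distrib inner_add_left inner_add_right)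
  then show ?thesis
    by (simp add: vec_eq_iff transpose_def matrix_vector_mul_component inner_axis' inner_axis
        matrix_vector_mult_basis column_def eq_neg_iff_add_eq_0)
qed

text \<open>Cyclicity of the trace carries one factor \<open>B\<close> to the front, and
  anticommuting it back past \<open>S\<close> flips the sign, so the trace equals its own
  negative.\<close>

lemma trace_mult_square_of_anticommute:
  fixes S B :: "real ^ 'n ^ 'n"
  assumes "B ** S = - (S ** B)"
  shows "trace (S ** (B ** B)) = 0"
proof -
  have "trace (S ** (B ** B)) = trace (B ** (S ** B))"
    by (metis matrix_mul_assoc trace_mul_sym)
  also have "\<dots> = trace (- (S ** B) ** B)"
    by (metis assms matrix_mul_assoc)
  also have "\<dots> = - trace (S ** (B ** B))"
    by (simp add: trace_def matrix_mul_assoc matrix_matrix_mult_def[of "- _"]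
        matrix_matrix_mult_def[of "_ ** _"] sum_negf)
  finally show ?thesis by simp
qed

lemma symmetric_eq_0_of_anticommute_sum_squares:
  fixes B1 B2 B3 :: "real ^ 'n ^ 'n"
  defines "S \<equiv> B1 ** B1 + B2 ** B2 + B3 ** B3"
  assumes sym: "transpose B1 = B1" "transpose B2 = B2" "transpose B3 = B3"
    and anti: "B1 ** S = - (S ** B1)" "B2 ** S = - (S ** B2)" "B3 ** S = - (S ** B3)"
  shows "B1 = 0 \<and> B2 = 0 \<and> B3 = 0"
proof -
  have "transpose S = S"
    by (simp add: S_def transpose_add matrix_transpose_mul sym)
  moreover have "trace (S ** S) = trace (S ** (B1 ** B1)) + trace (S ** (B2 ** B2))
      + trace (S ** (B3 ** B3))"
    \<comment> \<open>Only the right factor is expanded; the left \<open>S\<close> stays whole for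
      the anticommutation relations.\<close>
    by (subst (2) S_def) (simp add: matrix_add_ldistrib trace_add)
  then have "trace (S ** S) = 0"
    by (simp add: anti trace_mult_square_of_anticommute)
  ultimately have "S = 0"
    by (simp add: trace_symmetric_square_eq_0_iff)
  then have "trace (B1 ** B1) + trace (B2 ** B2) + trace (B3 ** B3) = 0"
    by (metis S_def trace_add trace_0 mat_0)
  then show ?thesis
    using sym[THEN trace_symmetric_square_nonneg] sym[THEN trace_symmetric_square_eq_0_iff]
    by linarith
qed

text \<open>The standard basis is orthonormal, so the Gram matrix and its inverse are the identity
  and only diagonal terms survive.\<close>

lemma metric_trace_flat:
  "metric_trace flat_metric p b = (\<Sum>i\<in>UNIV. b (axis i 1) (axis i 1))"
proof -
  have gram: "gram_matrix (flat_metric p) = (mat 1 :: real ^ 'a ^ 'a)"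
    by (simp add: gram_matrix_def flat_metric_def mat_def vec_eq_iff inner_axis_axis)
  have inv: "matrix_inv (mat 1 :: real ^ 'a ^ 'a) = mat 1"
    unfolding matrix_inv_def by (rule some_equality) auto
  show ?thesis
    unfolding metric_trace_def gram inv
    by (simp add: mat_def gram_matrix_def if_distrib[of "\<lambda>x. x * _"] cong: if_cong)
qed

text \<open>Replaces the definite description in \<open>grad\<close> by its defining identity, the
  only property of the gradient used below.\<close>

lemma inner_grad_flat:
  assumes "f differentiable (at p)"
  shows "grad flat_metric f p \<bullet> w = frechet_derivative f (at p) w"
  using grad_characterization[OF riemannian_metric_flat assms] by (simp add: flat_metric_def)

lemma inner_transpose:
  fixes A :: "real ^ 'n ^ 'm"
  shows "(transpose A *v x) \<bullet> y = x \<bullet> (A *v y)"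
  by (simp add: dot_lmul_matrix)

text \<open>As \<open>A\<close> may fail to be symmetric, the gradient is
  \<open>(A + transpose A) *v p\<close>; this is the source of the matrices \<open>B1\<close>,
  \<open>B2\<close>, \<open>B3\<close>.\<close>

lemma has_derivative_quadratic_form:
  fixes A :: "real ^ 'n ^ 'n"
  shows "((\<lambda>x. x \<bullet> (A *v x)) has_derivative (\<lambda>v. ((A + transpose A) *v p) \<bullet> v)) (at p)"
proof -
  have "((\<lambda>x. x \<bullet> (A *v x)) has_derivative (\<lambda>v. p \<bullet> (A *v v) + v \<bullet> (A *v p))) (at p)"
    by (intro has_derivative_inner has_derivative_ident bounded_linear_imp_has_derivative
        matrix_vector_mul_bounded_linear)
  moreover have "p \<bullet> (A *v v) + v \<bullet> (A *v p) = ((A + transpose A) *v p) \<bullet> v" for v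
    by (simp only: matrix_vector_mult_add_rdistrib inner_add_left inner_transpose)
      (simp add: inner_commute)
  ultimately show ?thesis by simp
qed

lemma has_derivative_quadratic_map:
  "(quadratic_map A1 A2 A3 has_derivative
     (\<lambda>v. vector [((A1 + transpose A1) *v p) \<bullet> v, ((A2 + transpose A2) *v p) \<bullet> v,
        ((A3 + transpose A3) *v p) \<bullet> v])) (at p)"
proof -
  have "((\<lambda>x. quadratic_map A1 A2 A3 x $ k) has_derivative
      (\<lambda>v. (vector [((A1 + transpose A1) *v p) \<bullet> v, ((A2 + transpose A2) *v p) \<bullet> v,
        ((A3 + transpose A3) *v p) \<bullet> v] :: real ^ 3) $ k)) (at p)" for k :: 3
    using exhaust_3[of k]
    by (auto simp: quadratic_map_def has_derivative_quadratic_form)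
  then show ?thesis
    by (subst has_derivative_componentwise_within)
      (auto simp: Basis_vec_def inner_axis)
qed

text \<open>The three squares are the norms of the pullbacks of the orthonormal coframe dx, dy, dz -
  x dy; in the last one x is the first coordinate of the image,
  \<open>p \<bullet> (A1 *v p)\<close>.\<close>

lemma energy_density_quadratic_map:
  fixes A1 A2 A3 :: "real ^ 'm ^ 'm"
  defines "B1 \<equiv> A1 + transpose A1" and "B2 \<equiv> A2 + transpose A2" and "B3 \<equiv> A3 + transpose A3"
  shows "energy_density flat_metric nil_metric (quadratic_map A1 A2 A3) p =
    (B1 *v p) \<bullet> (B1 *v p) + (B2 *v p) \<bullet> (B2 *v p)
      + (B3 *v p - (p \<bullet> (A1 *v p)) *\<^sub>R (B2 *v p)) \<bullet> (B3 *v p - (p \<bullet> (A1 *v p)) *\<^sub>R (B2 *v p))"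
proof -
  have "frechet_derivative (quadratic_map A1 A2 A3) (at p) (axis i 1)
      = vector [(B1 *v p) $ i, (B2 *v p) $ i, (B3 *v p) $ i]" for i
    by (simp add: frechet_derivative_at[OF has_derivative_quadratic_map, symmetric] inner_axis
        B1_def B2_def B3_def)
  then show ?thesis
    unfolding energy_density_def metric_trace_flat pullback_def nil_metric_def
    by (simp add: quadratic_map_def inner_vec_def sum.distrib)
qed

text \<open>The rows of the differential are \<open>B1 *v p\<close>, \<open>B2 *v p\<close>,
  \<open>B3 *v p\<close>, so the equation makes the energy gradient orthogonal to each of them. The
  left-hand side is half the derivative of the energy in the direction
  \<open>B *v p\<close>.\<close>

lemma infinity_harmonic_quadratic_map_derivative:
  fixes A1 A2 A3 :: "real ^ 'm ^ 'm"
  defines "B1 \<equiv> A1 + transpose A1" and "B2 \<equiv> A2 + transpose A2" and "B3 \<equiv> A3 + transpose A3"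
  assumes harm: "infinity_harmonic flat_metric nil_metric (quadratic_map A1 A2 A3)"
    and B: "B \<in> {B1, B2, B3}"
  shows "(B1 *v p) \<bullet> (B1 *v (B *v p)) + (B2 *v p) \<bullet> (B2 *v (B *v p))
    + (B3 *v p - (p \<bullet> (A1 *v p)) *\<^sub>R (B2 *v p)) \<bullet>
      (B3 *v (B *v p) - (p \<bullet> (A1 *v p)) *\<^sub>R (B2 *v (B *v p))
        - ((B1 *v p) \<bullet> (B *v p)) *\<^sub>R (B2 *v p)) = 0"
proof -
  let ?E = "energy_density flat_metric nil_metric (quadratic_map A1 A2 A3)"
  let ?q = "p \<bullet> (A1 *v p)"
  let ?D = "\<lambda>v. 2 * ((B1 *v p) \<bullet> (B1 *v v) + (B2 *v p) \<bullet> (B2 *v v)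
    + (B3 *v p - ?q *\<^sub>R (B2 *v p)) \<bullet>
      (B3 *v v - ?q *\<^sub>R (B2 *v v) - ((B1 *v p) \<bullet> v) *\<^sub>R (B2 *v p)))"
  have lin: "((\<lambda>x. M *v x) has_derivative (\<lambda>v. M *v v)) (at p)" for M :: "real ^ 'm ^ 'm"
    by (intro bounded_linear_imp_has_derivative matrix_vector_mul_bounded_linear)
  have square: "((\<lambda>x. F x \<bullet> F x) has_derivative (\<lambda>v. 2 * (F p \<bullet> F' v))) (at p)"
    if "(F has_derivative F') (at p)" for F F' :: "real ^ 'm \<Rightarrow> real ^ 'm"
    using has_derivative_inner[OF that that] by (simp add: inner_commute)
  \<comment> \<open>The coefficient of \<open>B2 *v x\<close> depends on the point as well; the
    product rule contributes the last term.\<close>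
  have third: "((\<lambda>x. B3 *v x - (x \<bullet> (A1 *v x)) *\<^sub>R (B2 *v x)) has_derivative
      (\<lambda>v. B3 *v v - ?q *\<^sub>R (B2 *v v) - ((B1 *v p) \<bullet> v) *\<^sub>R (B2 *v p))) (at p)"
    using has_derivative_diff[OF lin[of B3]
        has_derivative_scaleR[OF has_derivative_quadratic_form[of A1, folded B1_def] lin[of B2]]]
    by (simp add: diff_diff_eq)
  have E: "?E = (\<lambda>p. (B1 *v p) \<bullet> (B1 *v p) + (B2 *v p) \<bullet> (B2 *v p)
      + (B3 *v p - (p \<bullet> (A1 *v p)) *\<^sub>R (B2 *v p)) \<bullet> (B3 *v p - (p \<bullet> (A1 *v p)) *\<^sub>R (B2 *v p)))"
    by (simp add: fun_eq_iff energy_density_quadratic_map B1_def B2_def B3_def)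
  have D: "(?E has_derivative ?D) (at p)"
    unfolding E
    using has_derivative_add[OF has_derivative_add[OF square[OF lin[of B1]] square[OF lin[of B2]]]
        square[OF third]]
    by (simp only: distrib_left)
  let ?G = "grad flat_metric ?E p"
  have inner_grad: "?G \<bullet> w = ?D w" for w
    using inner_grad_flat[OF differentiableI[OF D], of w]
    unfolding frechet_derivative_at[OF D, symmetric] .
  have "frechet_derivative (quadratic_map A1 A2 A3) (at p) ?G = 0"
    using harm by (simp add: infinity_harmonic_def)
  then have "(vector [(B1 *v p) \<bullet> ?G, (B2 *v p) \<bullet> ?G, (B3 *v p) \<bullet> ?G] :: real ^ 3) = 0"
    by (simp add: frechet_derivative_at[OF has_derivative_quadratic_map, symmetric]
        B1_def B2_def B3_def)
  then have "(B1 *v p) \<bullet> ?G = 0 \<and> (B2 *v p) \<bullet> ?G = 0 \<and> (B3 *v p) \<bullet> ?G = 0"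
    by (simp add: vec_eq_iff forall_3)
  then have "?G \<bullet> (B *v p) = 0"
    using B by (auto simp: inner_commute)
  then show ?thesis
    unfolding inner_grad by simp
qed

lemma infinity_harmonic_quadratic_map_anticommute:
  fixes A1 A2 A3 :: "real ^ 'm ^ 'm"
  defines "B1 \<equiv> A1 + transpose A1" and "B2 \<equiv> A2 + transpose A2" and "B3 \<equiv> A3 + transpose A3"
  assumes harm: "infinity_harmonic flat_metric nil_metric (quadratic_map A1 A2 A3)"
    and B: "B \<in> {B1, B2, B3}"
  shows "B ** (B1 ** B1 + B2 ** B2 + B3 ** B3) = - ((B1 ** B1 + B2 ** B2 + B3 ** B3) ** B)"
proof -
  let ?S = "B1 ** B1 + B2 ** B2 + B3 ** B3"
  have sym: "transpose B1 = B1" "transpose B2 = B2" "transpose B3 = B3"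
    by (simp_all add: B1_def B2_def B3_def transpose_add add.commute)
  have symB: "transpose B = B"
    using B sym by auto
  have "x \<bullet> ((?S ** B) *v x) = 0" for x
  proof -
    \<comment> \<open>Since \<open>q\<close> and \<open>r\<close> are quadratic and \<open>y\<close>
      is linear in \<open>x\<close>, the numbers \<open>a\<close>, \<open>b\<close>,
      \<open>c\<close> are the parts of degrees 2, 4 and 6 of the orthogonality relation at
      \<open>x\<close>.\<close>
    define q r y where "q = x \<bullet> (A1 *v x)" and "r = (B1 *v x) \<bullet> (B *v x)" and "y = B *v x"
    define a where "a = (B1 *v x) \<bullet> (B1 *v y) + (B2 *v x) \<bullet> (B2 *v y) + (B3 *v x) \<bullet> (B3 *v y)"
    define b where "b = - q * ((B3 *v x) \<bullet> (B2 *v y)) - q * ((B2 *v x) \<bullet> (B3 *v y))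
      - r * ((B3 *v x) \<bullet> (B2 *v x))"
    define c where "c = q\<^sup>2 * ((B2 *v x) \<bullet> (B2 *v y)) + q * r * ((B2 *v x) \<bullet> (B2 *v x))"
    have hom: "t\<^sup>2 * a + t ^ 4 * b + t ^ 6 * c = 0" for t
      using infinity_harmonic_quadratic_map_derivative[OF harm, of B "t *\<^sub>R x"] B
      by (simp add: matrix_vector_mult_scaleR a_def b_def c_def q_def r_def y_def
          B1_def[symmetric] B2_def[symmetric] B3_def[symmetric] inner_diff_left inner_diff_right
          algebra_simps power2_eq_square power4_eq_xxxx power_numeral_reduce)
    have "a = 0"
      \<comment> \<open>Three nonzero values of \<open>t\<close> with distinct squares give an
        invertible Vandermonde-type system for \<open>a\<close>, \<open>b\<close>,
        \<open>c\<close>.\<close>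
      using hom[of 1] hom[of 2] hom[of 3] by simp
    moreover have "(M *v x) \<bullet> (M *v y) = x \<bullet> ((M ** M) *v y)" if "transpose M = M"
      for M :: "real ^ 'm ^ 'm"
      using that by (metis dot_lmul_matrix matrix_vector_mul_assoc transpose_matrix_vector)
    ultimately show ?thesis
      by (simp add: a_def sym y_def matrix_vector_mult_add_rdistrib inner_add_right
          flip: matrix_vector_mul_assoc[of ?S])
  qed
  then have "transpose (?S ** B) = - (?S ** B)"
    by (rule quadratic_form_eq_0_imp_skew)
  \<comment> \<open>Both factors are symmetric, so transposing their product reverses it: skewness
    is anticommutation.\<close>
  then show ?thesis
    by (simp add: matrix_transpose_mul transpose_add sym symB)
qed

text \<open>The differential vanishes, so it kills whatever vector \<open>grad\<close> denotes;
  \<open>g\<close> and \<open>h\<close> may be arbitrary.\<close>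

lemma infinity_harmonic_const:
  "infinity_harmonic g h (\<lambda>_. c)"
proof -
  have "Ck k (\<lambda>_::real ^ 'a. c)" for k and c :: "real ^ 'b"
    by (induction k arbitrary: c) simp_all
  then show ?thesis
    by (simp add: infinity_harmonic_def smooth_def)
qed

theorem theorem7p2:
  fixes A1 A2 A3 :: "real ^ 'm ^ 'm"
  shows "infinity_harmonic flat_metric nil_metric (quadratic_map A1 A2 A3)
    \<longleftrightarrow> quadratic_map A1 A2 A3 constant_on UNIV"
proof
  assume harm: "infinity_harmonic flat_metric nil_metric (quadratic_map A1 A2 A3)"
  have transpose_sym: "transpose (A + transpose A) = A + transpose A" for A :: "real ^ 'm ^ 'm"
    by (simp add: transpose_add add.commute)
  have "A1 + transpose A1 = 0 \<and> A2 + transpose A2 = 0 \<and> A3 + transpose A3 = 0"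
    by (intro symmetric_eq_0_of_anticommute_sum_squares transpose_sym
        infinity_harmonic_quadratic_map_anticommute[OF harm]) simp_all
  \<comment> \<open>A matrix and its transpose have the same quadratic form, so the form of a skew
    matrix is zero.\<close>
  moreover have "x \<bullet> (A *v x) = 0" if "A + transpose A = 0" for A :: "real ^ 'm ^ 'm" and x
  proof -
    have "x \<bullet> (transpose A *v x) = x \<bullet> (A *v x)"
      by (metis dot_lmul_matrix inner_commute transpose_matrix_vector)
    moreover have "x \<bullet> ((A + transpose A) *v x) = 0"
      by (simp add: that)
    ultimately show ?thesis
      by (simp add: matrix_vector_mult_add_rdistrib inner_add_right)
  qed
  ultimately show "quadratic_map A1 A2 A3 constant_on UNIV"
    by (auto simp: constant_on_def quadratic_map_def)
next
  assume "quadratic_map A1 A2 A3 constant_on UNIV"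
  then obtain c where "quadratic_map A1 A2 A3 = (\<lambda>_. c)"
    by (auto simp: constant_on_def fun_eq_iff)
  then show "infinity_harmonic flat_metric nil_metric (quadratic_map A1 A2 A3)"
    by (simp add: infinity_harmonic_const)
qed

end
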